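(* Let $q$ be a prime power, $n$ a positive integer, and $t$ a divisor of $n$ with $1<t<n$. Let $f\in\mathcal{L}_{n,q}$ be an L-$q^t$-partially scattered polynomial. Then $(\mathbb{S}_f,+,\cdot)$ is not a field if and only if $n=2t$ and $f$ is equivalent to the polynomial $\ell^{q^t}-\ell$ (that is, to the $\mathbb{F}_q$-linear map $x\mapsto \ell(x)^{q^t}-\ell(x)$ of $\mathbb{F}_{q^{2t}}$) for some $\ell\in\mathcal{L}_{t,q}$.
   Context: For a positive integer $m$, $\mathcal{L}_{m,q}$ is the set of $q$-polynomials $\sum_{i=0}^{m-1}a_ix^{q^i}$ with $a_i\in\mathbb{F}_{q^m}$, identified with the $\mathbb{F}_q$-linear endomorphisms of $\mathbb{F}_{q^m}$. A polynomial $\ell=\sum_{i=0}^{t-1}c_ix^{q^i}\in\mathcal{L}_{t,q}$ ($c_i\in\mathbb{F}_{q^t}$) can also be evaluated on $\mathbb{F}_{q^{2t}}$. The graph of $f\in\mathcal{L}_{n,q}$ is $\mathcal{G}_f=\{(y,f(y)) : y\in\mathbb{F}_{q^n}\}\subseteq\mathbb{F}_{q^n}^2$, and $\mathbb{S}_f=\{A\in\mathbb{F}_{q^n}^{2\times2} : A\mathcal{G}_f\subseteq\mathcal{G}_f\}$ with $A\mathcal{G}_f=\left\{A\begin{pmatrix}y\\ f(y)\end{pmatrix} : y\in\mathbb{F}_{q^n}\right\}$, equipped with the usual sum and product of matrices. The polynomial $f$ is L-$q^t$-partially scattered if for all $y,z\in\mathbb{F}_{q^n}^*$, $\frac{f(y)}{y}=\frac{f(z)}{z}$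 implies $\frac{y}{z}\in\mathbb{F}_{q^t}$. Two polynomials $f,g\in\mathcal{L}_{n,q}$ are equivalent if there exists $\varphi\in\Gamma\mathrm{L}(2,q^n)$ with $\varphi(\mathcal{G}_f)=\mathcal{G}_g$, i.e. there exist $A\in\mathrm{GL}(2,q^n)$ and $\sigma\in\mathrm{Aut}(\mathbb{F}_{q^n})$ such that for each $x\in\mathbb{F}_{q^n}$ there is $y\in\mathbb{F}_{q^n}$ with $A\begin{pmatrix}x^\sigma\\ f(x)^\sigma\end{pmatrix}=\begin{pmatrix}y\\ g(y)\end{pmatrix}$. *)

theory Defs
  imports
    "HOL-Analysis.Analysis"
    "HOL-Algebra.Ring"
    "HOL-Computational_Algebra.Polynomial"
    "HOL-Number_Theory.Prime_Powers"
begin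

text \<open>
  Throughout, the type \<open>'a\<close> plays the role of the ambient field with \<open>q ^ n\<close> elements.
  Its subfield of order \<open>Q\<close> is the set of roots of \<open>X ^ Q - X\<close>; the lemmas below confirm that, for
  \<open>Q = q ^ t\<close> and \<open>t dvd n\<close>, this is the one and only subfield with \<open>Q\<close> elements.
\<close>

definition GF_sub :: "nat \<Rightarrow> 'a::finite_field set" where
  "GF_sub Q = {x. x ^ Q = x}"

lemma CHAR_eq_primepow_base:
  assumes "CARD('a::finite_field) = q ^ n" "q = p ^ k" "prime p"
  shows "CHAR('a) = p"
proof -
  have "(\<Sum>x\<in>(UNIV::'a set). x + 1) = (\<Sum>x\<in>UNIV. x)"
    by (rule sum.reindex_bij_witness[of _ "\<lambda>x. x - 1" "\<lambda>x. x + 1"]) auto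
  hence "of_nat CARD('a) = (0::'a)"
    by (simp add: sum.distrib)
  hence "CHAR('a) dvd CARD('a)"
    by (simp only: of_nat_eq_0_iff_char_dvd)
  hence "CHAR('a) dvd p ^ (k * n)"
    by (simp only: assms(1,2) power_mult)
  moreover have "prime CHAR('a)"
    by (rule prime_CHAR_semidom) (rule finite_imp_CHAR_pos, simp)
  ultimately show ?thesis
    using assms(3) prime_dvd_power primes_dvd_imp_eq by blast
qed

lemma GF_sub_add_closed:
  fixes x y :: "'a::finite_field"
  assumes "CARD('a) = q ^ n" "primepow q" "x \<in> GF_sub (q ^ t)" "y \<in> GF_sub (q ^ t)"
  shows "x + y \<in> GF_sub (q ^ t)"
proof -
  obtain p k where pk: "prime p" "q = p ^ k"
    using assms(2) by (auto simp: primepow_def)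
  have "CHAR('a) = p"
    using CHAR_eq_primepow_base[OF assms(1) pk(2,1)] .
  moreover have "q ^ t = p ^ (k * t)"
    using pk by (simp add: power_mult)
  ultimately have "(x + y) ^ (q ^ t) = x ^ (q ^ t) + y ^ (q ^ t)"
    using pk(1) by (intro freshmans_dream'[of _ "k * t"]) auto
  thus ?thesis
    using assms(3,4) by (simp add: GF_sub_def)
qed

lemma GF_sub_closed:
  fixes x y :: "'a::finite_field"
  assumes "primepow q"
  shows "(0::'a) \<in> GF_sub (q ^ t)" "(1::'a) \<in> GF_sub (q ^ t)"
    and "x \<in> GF_sub (q ^ t) \<Longrightarrow> y \<in> GF_sub (q ^ t) \<Longrightarrow> x * y \<in> GF_sub (q ^ t)"
    and "x \<in> GF_sub (q ^ t) \<Longrightarrow> inverse x \<in> GF_sub (q ^ t)"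
  using primepow_gt_Suc_0[OF assms]
  by (auto simp: GF_sub_def power_mult_distrib power_inverse)

lemma GF_sub_uminus_closed:
  fixes x :: "'a::finite_field"
  assumes "CARD('a) = q ^ n" "primepow q" "x \<in> GF_sub (q ^ t)"
  shows "- x \<in> GF_sub (q ^ t)"
proof -
  have pos: "q ^ t > 0"
    using primepow_gt_Suc_0[OF assms(2)] by simp
  obtain p k where pk: "prime p" "q = p ^ k"
    using assms(2) by (auto simp: primepow_def)
  have "CHAR('a) = p"
    using CHAR_eq_primepow_base[OF assms(1) pk(2,1)] .
  moreover have "q ^ t = p ^ (k * t)"
    using pk by (simp add: power_mult)
  ultimately have "(x + - x) ^ (q ^ t) = x ^ (q ^ t) + (- x) ^ (q ^ t)"
    using pk(1) by (intro freshmans_dream'[of _ "k * t"]) auto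
  thus ?thesis
    using assms(3) pos by (simp add: GF_sub_def zero_power eq_neg_iff_add_eq_0 add.commute)
qed

lemma frobenius_poly:
  fixes Q :: nat
  assumes "Q > 1"
  defines "P \<equiv> monom 1 Q - monom 1 1 :: 'a::finite_field poly"
  shows "P \<noteq> 0" "degree P = Q" "GF_sub Q = {x. poly P x = 0}"
proof -
  show d: "degree P = Q"
    unfolding P_def using assms(1)
    by (subst diff_conv_add_uminus, subst degree_add_eq_left) (auto simp: degree_monom_eq)
  show "P \<noteq> 0"
    using d assms(1) by auto
  show "GF_sub Q = {x. poly P x = 0}"
    by (auto simp: GF_sub_def P_def poly_monom)
qed

lemma card_GF_sub:
  assumes "CARD('a::finite_field) = q ^ n" "primepow q" "t dvd n" "0 < t"
  shows "card (GF_sub (q ^ t) :: 'a set) = q ^ t"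
proof -
  have q: "q > 1"
    using primepow_gt_Suc_0[OF assms(2)] by simp
  define Q where "Q = q ^ t"
  obtain k where k: "n = t * k"
    using assms(3) by auto
  have card: "CARD('a) = Q ^ k"
    using assms(1) k by (simp add: Q_def power_mult)
  have Q: "Q > 1"
    unfolding Q_def using q assms(4) by (rule one_less_power)
  have "CARD('a) > 1"
    using card_mono[of UNIV "{0, 1::'a}"] by simp
  hence N: "Q ^ k > 1"
    using card by simp
  define P where "P = (monom 1 Q - monom 1 1 :: 'a poly)"
  define R where "R = (monom 1 (Q ^ k) - monom 1 1 :: 'a poly)"
  have "(Q - 1) dvd (Q ^ k - 1)"
  proof (induction k)
    case (Suc k)
    have "Q ^ Suc k - 1 = (Q - 1) * Q ^ k + (Q ^ k - 1)"
      using Q by (simp add: diff_mult_distrib)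
    thus ?case
      using Suc.IH by simp
  qed simp
  then obtain m where m: "Q ^ k - 1 = (Q - 1) * m" by auto
  have X: "monom (1::'a) j - monom 1 1 = monom 1 1 * (monom 1 1 ^ (j - 1) - 1)" if "j > 1" for j
    using that by (simp add: monom_power mult_monom right_diff_distrib)
  have "P dvd R"
  proof -
    have "monom (1::'a) 1 ^ (Q - 1) - 1 dvd (monom (1::'a) 1 ^ (Q - 1)) ^ m - 1"
      by (simp add: power_diff_1_eq)
    thus ?thesis
      unfolding P_def R_def X[OF Q] X[OF N] m by (simp add: power_mult mult_dvd_mono)
  qed
  then obtain G where G: "R = P * G" by auto
  have R: "R \<noteq> 0" "degree R = Q ^ k" "GF_sub (Q ^ k) = {x. poly R x = 0}"
    using frobenius_poly[where ?'a = 'a, OF N] unfolding R_def by auto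
  have P: "P \<noteq> 0" "degree P = Q" "GF_sub Q = {x. poly P x = 0}"
    using frobenius_poly[where ?'a = 'a, OF Q] unfolding P_def by auto
  have G0: "G \<noteq> 0"
    using R(1) G by auto
  have deg: "Q ^ k = Q + degree G"
    using G G0 P R by (metis degree_mult_eq)
  have "(UNIV::'a set) = {x. poly R x = 0}"
    using R(3) card finite_field_power_card_eq_same[where ?'a = 'a] by (auto simp: GF_sub_def)
  also have "\<dots> = {x. poly P x = 0} \<union> {x. poly G x = 0}"
    using G by auto
  finally have "Q ^ k \<le> card {x. poly P x = 0} + card {x. poly G x = 0}"
    using card card_Un_le by metis
  moreover have "card {x. poly G x = 0} \<le> degree G" "card {x. poly P x = 0} \<le> Q"
    using card_poly_roots_bound G0 P by metis+
  ultimately have "card {x. poly P x = 0} = Q"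
    using deg by linarith
  thus ?thesis
    using P(3) by (simp add: Q_def)
qed

lemma GF_sub_unique:
  fixes K :: "'a::finite_field set"
  assumes "CARD('a) = q ^ n" "primepow q" "t dvd n" "0 < t"
    and "card K = q ^ t"
    and "0 \<in> K" "\<And>x y. x \<in> K \<Longrightarrow> y \<in> K \<Longrightarrow> x * y \<in> K"
  shows "K = GF_sub (q ^ t)"
proof -
  have "x ^ card K = x" if "x \<in> K" for x
  proof (cases "x = 0")
    case True
    have "card K > 0" using assms(6) by (auto simp: card_gt_0_iff)
    thus ?thesis using True by simp
  next
    case False
    have sub: "(\<lambda>y. x * y) ` (K - {0}) \<subseteq> K - {0}"
      using that False assms(7) by auto
    have inj: "inj_on (\<lambda>y. x * y) (K - {0})"
      using False by (auto simp: inj_on_def)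
    have im: "(\<lambda>y. x * y) ` (K - {0}) = K - {0}"
      by (rule endo_inj_surj[OF _ sub inj]) simp
    have "(\<Prod>y\<in>K - {0}. y) = (\<Prod>y\<in>K - {0}. x * y)"
      by (subst im[symmetric], subst prod.reindex[OF inj]) (simp add: o_def)
    also have "\<dots> = x ^ (card K - 1) * (\<Prod>y\<in>K - {0}. y)"
      using assms(6) by (simp add: prod.distrib)
    finally have "x ^ (card K - 1) = 1"
      by simp
    moreover have "card K > 0" using assms(6) by (auto simp: card_gt_0_iff)
    ultimately show ?thesis
      by (metis power_minus_mult mult_1)
  qed
  hence "K \<subseteq> GF_sub (q ^ t)"
    using assms(5) by (auto simp: GF_sub_def)
  thus ?thesis
    using card_GF_sub[OF assms(1-4)] assms(5) by (intro card_subset_eq) auto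
qed

text \<open>\<open>qpolys q m\<close> is \<open>L_{m,q}\<close>, with coefficients and variable read inside the ambient field \<open>'a\<close>.\<close>

definition qpolys :: "nat \<Rightarrow> nat \<Rightarrow> 'a::finite_field poly set" where
  "qpolys q m = {\<Sum>i<m. monom (a i) (q ^ i) | a. \<forall>i<m. a i \<in> GF_sub (q ^ m)}"

definition graph_of :: "'a::finite_field poly \<Rightarrow> ('a ^ 2) set" where
  "graph_of f = {vector [y, poly f y] | y. True}"

definition stab_set :: "'a::finite_field poly \<Rightarrow> ('a ^ 2 ^ 2) set" where
  "stab_set f = {A. (\<lambda>v. A *v v) ` graph_of f \<subseteq> graph_of f}"

definition stab_ring :: "'a::finite_field poly \<Rightarrow> ('a ^ 2 ^ 2) ring" where
  "stab_ring f =
    \<lparr>carrier = stab_set f, mult = (**), one = mat 1, zero = 0, add = (+)\<rparr>"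

definition L_partially_scattered :: "nat \<Rightarrow> 'a::finite_field poly \<Rightarrow> bool" where
  "L_partially_scattered Q f \<longleftrightarrow>
    (\<forall>y z. y \<noteq> 0 \<longrightarrow> z \<noteq> 0 \<longrightarrow> poly f y / y = poly f z / z \<longrightarrow> y / z \<in> GF_sub Q)"

definition field_aut :: "('a::finite_field \<Rightarrow> 'a) set" where
  "field_aut = {\<sigma>. bij \<sigma> \<and> (\<forall>x y. \<sigma> (x + y) = \<sigma> x + \<sigma> y) \<and> (\<forall>x y. \<sigma> (x * y) = \<sigma> x * \<sigma> y)}"

definition GammaL2 :: "('a::finite_field ^ 2 \<Rightarrow> 'a ^ 2) set" where
  "GammaL2 = {(\<lambda>v. A *v (\<chi> i. \<sigma> (v $ i))) | (A :: 'a ^ 2 ^ 2) \<sigma>. invertible A \<and> \<sigma> \<in> field_aut}"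

definition qpoly_equiv :: "'a::finite_field poly \<Rightarrow> 'a poly \<Rightarrow> bool" where
  "qpoly_equiv f g \<longleftrightarrow> (\<exists>\<phi>\<in>GammaL2. \<phi> ` graph_of f = graph_of g)"

end

theory Submission
  imports Defs
begin

text \<open>
  Write \<open>K\<close> for the subfield with \<open>q ^ t\<close> elements. A finite ring of
  \<open>2 \<times> 2\<close> matrices all of whose nonzero elements are invertible is a field, so if the stabiliser is
  not a field it contains a matrix of rank one, \<open>(y, z) \<mapsto> (a y + b z) w\<close>. Put \<open>\<psi>(y) = a y + b f(y)\<close>.
  Partial scatteredness confines both the kernel and the range of \<open>\<psi>\<close> to sets of the form \<open>u K\<close>, so
  counting gives \<open>n = 2 t\<close> and equality in both. After rescaling, \<open>g(x) = c \<psi>(x y0)\<close> vanishes on \<open>K\<close> and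
  satisfies \<open>g(x) ^ (q ^ t) = - g(x)\<close>. Comparing coefficients, the first property forces
  \<open>g(x) = \<Sum>i<t. e i * (x ^ (q ^ (i + t)) - x ^ (q ^ i))\<close> and the second forces \<open>e i \<in> K\<close>.
  Conversely, if \<open>\<delta> ^ (q ^ t) = - \<delta>\<close>, the nilpotent matrix \<open>(y, z) \<mapsto> (z / \<delta>, 0)\<close> stabilises the graph
  of \<open>l ^ (q ^ t) - l\<close>, and nilpotents are carried along by equivalence.
\<close>

section \<open>Two-by-two matrices and the commutativity of finite division rings among them\<close>

lemma mat2_eq_iff:
  "A = B \<longleftrightarrow> A$1$1 = B$1$1 \<and> A$1$2 = B$1$2 \<and> A$2$1 = B$2$1 \<and> A$2$2 = B$2$2"
  for A B :: "'a ^ 2 ^ 2"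
  by (auto simp: vec_eq_iff forall_2)

lemma matrix_mult_2: "(A ** B) $ i $ j = A$i$1 * B$1$j + A$i$2 * B$2$j"
  for A B :: "'a::semiring_1 ^ 2 ^ 2"
  by (simp add: matrix_matrix_mult_def sum_2)

lemma mat_2: "(mat c :: 'a::zero ^ 2 ^ 2) $ 1 $ 1 = c" "(mat c :: 'a ^ 2 ^ 2) $ 1 $ 2 = 0"
    "(mat c :: 'a ^ 2 ^ 2) $ 2 $ 1 = 0" "(mat c :: 'a ^ 2 ^ 2) $ 2 $ 2 = c"
  by (simp_all add: mat_def)

lemmas mat2_simps = mat2_eq_iff matrix_mult_2 mat_2

text \<open>Squares make up more than half of \<open>Z\<close>, so the set of squares and its image
  under the injective map \<open>s \<mapsto> b + a * s\<close> cannot be disjoint inside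
  \<open>Z\<close>.\<close>

lemma exists_square_eq_add_mult_square:
  fixes Z :: "'a::field set"
  assumes "finite Z" "0 \<in> Z" "a \<in> Z" "b \<in> Z" "a \<noteq> 0"
    and add: "\<And>x y. x \<in> Z \<Longrightarrow> y \<in> Z \<Longrightarrow> x + y \<in> Z"
    and mult: "\<And>x y. x \<in> Z \<Longrightarrow> y \<in> Z \<Longrightarrow> x * y \<in> Z"
  shows "\<exists>x\<in>Z. \<exists>y\<in>Z. x\<^sup>2 = b + a * y\<^sup>2"
proof (rule ccontr)
  assume neg: "\<not> ?thesis"
  define S where "S = (\<lambda>x. x\<^sup>2) ` Z"
  define T where "T = (\<lambda>s. b + a * s) ` S"
  have "\<forall>s\<in>S. \<exists>x\<in>Z. x\<^sup>2 = s"
    by (auto simp: S_def)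
  then obtain g where g: "g s \<in> Z" "(g s)\<^sup>2 = s" if "s \<in> S" for s
    by metis
  have fin: "finite S"
    using assms(1) by (simp add: S_def)
  have S0: "0 \<in> S"
    using assms(2) by (force simp: S_def)
  have "g 0 = 0"
    using g(2)[OF S0] by simp
  \<comment> \<open>\<open>g\<close> picks one root of each square, so every element is a picked
    root or the negative of one. Leaving out 0 the second time makes the count strict.\<close>
  have "Z \<subseteq> g ` S \<union> (\<lambda>s. - g s) ` (S - {0})"
  proof
    fix z assume z: "z \<in> Z"
    have zS: "z\<^sup>2 \<in> S"
      using z by (simp add: S_def)
    have "z = g (z\<^sup>2) \<or> z = - g (z\<^sup>2)"
      using g(2)[OF zS] by (metis power2_eq_iff)
    thus "z \<in> g ` S \<union> (\<lambda>s. - g s) ` (S - {0})"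
      using zS \<open>g 0 = 0\<close> by (cases "z = 0") (force intro: image_eqI[of _ _ "z\<^sup>2"])+
  qed
  hence "card Z \<le> card (g ` S \<union> (\<lambda>s. - g s) ` (S - {0}))"
    by (intro card_mono) (use fin in auto)
  also have "\<dots> \<le> card (g ` S) + card ((\<lambda>s. - g s) ` (S - {0}))"
    by (rule card_Un_le)
  also have "\<dots> \<le> card S + card (S - {0})"
    by (intro add_mono card_image_le) (use fin in auto)
  also have "\<dots> < card S + card S"
    using card_Diff1_less[OF fin S0] by simp
  finally have "card Z < card S + card S" .
  moreover have "card T = card S"
    unfolding T_def using assms(5) by (subst card_image) (auto simp: inj_on_def)
  moreover have "card (S \<union> T) = card S + card T"
  proof (rule card_Un_disjoint)
    show "S \<inter> T = {}"
      using neg by (auto simp: S_def T_def)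
  qed (use fin in \<open>auto simp: T_def\<close>)
  moreover have "card (S \<union> T) \<le> card Z"
    using assms by (intro card_mono) (auto simp: S_def T_def power2_eq_square)
  ultimately show False
    by simp
qed

text \<open>By Cayley-Hamilton, with \<open>s\<close> the trace of \<open>A\<close>, both sides
  equal \<open>s X A - A X A - (det A) X\<close>.\<close>

lemma commutator_mult_2:
  fixes A X :: "'a::comm_ring_1 ^ 2 ^ 2"
  shows "(X ** A - A ** X) ** A = (mat (A$1$1 + A$2$2) - A) ** (X ** A - A ** X)"
  by (simp add: mat2_simps algebra_simps)

text \<open>Cayley-Hamilton without its linear term.\<close>

lemma square_traceless_2:
  fixes A :: "'a::comm_ring_1 ^ 2 ^ 2"
  assumes "A$1$1 + A$2$2 = 0"
  shows "A ** A = mat (- det A)"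
proof -
  have "A$2$2 = - A$1$1"
    using assms by (metis minus_unique)
  thus ?thesis
    by (simp add: mat2_simps det_2 algebra_simps)
qed

text \<open>
  A replacement for Wedderburn's little theorem. If \<open>A\<close> and \<open>X\<close> do not commute, the commutator \<open>B\<close> of
  \<open>X\<close> and \<open>A\<close> conjugates \<open>A\<close> into its adjugate, so the trace of \<open>A\<close> and the square of \<open>B\<close> are
  scalars of \<open>S\<close>. In characteristic 2 square roots of scalars are scalar, which makes first \<open>B\<close> and
  then \<open>A\<close> scalar; otherwise \<open>S\<close> contains a quaternion algebra over a finite field, hence zero divisors.
\<close>

lemma finite_mat2_division_ring_commute:
  fixes S :: "('a::field ^ 2 ^ 2) set"
  assumes fin: "finite S"
    and one: "mat 1 \<in> S"
    and diff: "\<And>A B. A \<in> S \<Longrightarrow> B \<in> S \<Longrightarrow> A - B \<in> S"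
    and mult: "\<And>A B. A \<in> S \<Longrightarrow> B \<in> S \<Longrightarrow> A ** B \<in> S"
    and inv: "\<And>A. A \<in> S \<Longrightarrow> A \<noteq> 0 \<Longrightarrow> \<exists>B\<in>S. A ** B = mat 1"
    and A: "A \<in> S" and X: "X \<in> S"
  shows "A ** X = X ** A"
proof (rule ccontr)
  assume noncomm: "A ** X \<noteq> X ** A"
  have zero: "0 \<in> S"
    using diff[OF one one] by simp
  have add: "U + V \<in> S" if "U \<in> S" "V \<in> S" for U V
    using diff[OF that(1) diff[OF zero that(2)]] by simp
  have nozd: "U = 0 \<or> V = 0" if UV: "U \<in> S" "V \<in> S" "U ** V = 0" for U V
  proof (rule ccontr)
    assume "\<not> (U = 0 \<or> V = 0)"
    then obtain U' V' where "U ** U' = mat 1" "V ** V' = mat 1"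
      using inv UV(1,2) by metis
    hence "mat 1 = U ** (V ** V') ** U'"
      by simp
    also have "\<dots> = (U ** V) ** V' ** U'"
      by (simp add: matrix_mul_assoc)
    also have "\<dots> = 0"
      using UV by (simp add: mat2_simps)
    finally show False
      by (simp add: mat2_simps)
  qed
  \<comment> \<open>The scalars in \<open>S\<close> form a finite field, in which the square roots
    below are sought.\<close>
  define Z where "Z = {z. mat z \<in> S}"
  have mat_diff: "mat (x - y) = mat x - (mat y :: 'a ^ 2 ^ 2)"
    and mat_add: "mat (x + y) = mat x + (mat y :: 'a ^ 2 ^ 2)"
    and mat_mult: "mat (x * y) = mat x ** (mat y :: 'a ^ 2 ^ 2)" for x y
    by (simp_all add: mat2_simps)
  have Z_diff: "x - y \<in> Z" and Z_add: "x + y \<in> Z" and Z_mult: "x * y \<in> Z"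
    if "x \<in> Z" "y \<in> Z" for x y
    using that diff add mult by (simp_all add: Z_def mat_diff mat_add mat_mult)
  have Z01: "0 \<in> Z" "1 \<in> Z"
    using zero one by (simp_all add: Z_def)
  have "inj (mat :: 'a \<Rightarrow> 'a ^ 2 ^ 2)"
    by (auto simp: inj_def mat2_simps)
  hence finZ: "finite Z"
    unfolding Z_def using finite_vimageI[OF fin] by (simp add: vimage_def)
  have Z_inverse: "inverse z \<in> Z" if z: "z \<in> Z" for z
  proof (cases "z = 0")
    case False
    then obtain V where V: "V \<in> S" "mat z ** V = mat 1"
      using inv[of "mat z"] z by (auto simp: Z_def mat2_simps)
    hence "V = mat (inverse z)"
      using False by (auto simp: mat2_simps field_simps)
    thus ?thesis
      using V by (simp add: Z_def)
  qed (use Z01 in simp)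

  define B where "B = X ** A - A ** X"
  define s where "s = A$1$1 + A$2$2"
  define b where "b = - det B"
  have B: "B \<in> S" "B \<noteq> 0"
    using A X noncomm by (auto simp: B_def diff mult)
  have BA: "B ** A = (mat s - A) ** B"
    unfolding B_def s_def by (rule commutator_mult_2)
  have BB: "B ** B = mat b"
    unfolding b_def by (rule square_traceless_2) (simp add: B_def mat2_simps algebra_simps)
  have b: "b \<in> Z"
    using mult[OF B(1) B(1)] BB by (simp add: Z_def)
  obtain B' where B': "B' \<in> S" "B ** B' = mat 1"
    using inv B by blast
  \<comment> \<open>As \<open>B\<close> is invertible in \<open>S\<close>, the relation
    \<open>BA\<close> can be solved for the trace, which becomes an expression in elements of
    \<open>S\<close>.\<close>
  have "mat s = (mat s - A) ** (B ** B') + A"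
    by (simp add: B')
  also have "\<dots> = B ** A ** B' + A"
    by (simp add: matrix_mul_assoc BA)
  finally have s: "s \<in> Z"
    unfolding Z_def using A B B' by (simp add: mult add)

  show False
  proof (cases "(2 :: 'a) = 0")
    case True
    \<comment> \<open>Squaring is injective in characteristic 2, hence maps the finite set
      \<open>Z\<close> onto itself.\<close>
    have sq: "\<exists>x\<in>Z. x * x = z" if "z \<in> Z" for z
    proof -
      have "inj_on (\<lambda>x. x * x) Z"
      proof
        fix x y :: 'a assume "x * x = y * y"
        hence "(x - y) * (x - y) = 2 * (y * y - x * y)"
          by (simp add: algebra_simps)
        thus "x = y"
          using True by simp
      qed
      hence "(\<lambda>x. x * x) ` Z = Z"
        using finZ Z_mult by (intro endo_inj_surj) auto
      hence "z \<in> (\<lambda>x. x * x) ` Z"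
        using that by simp
      thus ?thesis
        by auto
    qed
    have scalar: "\<exists>x. C = mat x" if C: "C \<in> S" "C ** C = mat z" for C z
    proof -
      have "z \<in> Z"
        using mult[OF C(1) C(1)] C(2) by (simp add: Z_def)
      then obtain x where x: "x \<in> Z" "x * x = z"
        using sq by blast
      \<comment> \<open>The mixed term \<open>2 x C\<close> vanishes in characteristic 2, and so
        does \<open>2 x x\<close>. Thus \<open>C - mat x\<close> squares to zero.\<close>
      have "(C - mat x) ** (C - mat x) = C ** C - (mat x ** C + C ** mat x) + mat (x * x)"
        by (simp add: mat2_simps algebra_simps)
      also have "\<dots> = mat (x * x) + mat (x * x)"
        by (simp add: C x(2)[symmetric], simp add: mat2_simps True mult.commute[of _ x])
      also have "\<dots> = 0"
        by (simp add: mat2_simps True)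
      finally have "C - mat x = 0"
        using nozd[of "C - mat x" "C - mat x"] C x by (auto simp: diff Z_def)
      thus ?thesis
        by auto
    qed
    obtain x where x: "B = mat x"
      using scalar[OF B(1) BB] by blast
    have "x \<noteq> 0"
      using x B(2) by auto
    \<comment> \<open>With \<open>B\<close> a nonzero scalar, the upper left entries of
      \<open>BA\<close> give the trace \<open>2 * A$1$1 = 0\<close>. So \<open>A\<close> has a
      scalar square as well.\<close>
    have "x * A$1$1 = (s - A$1$1) * x"
      using BA by (simp add: x mat2_simps)
    hence "s = 2 * A$1$1"
      using \<open>x \<noteq> 0\<close> by (simp add: algebra_simps)
    hence "s = 0"
      using True by simp
    hence "A ** A = mat (- det A)"
      by (intro square_traceless_2) (simp add: s_def)
    then obtain y where "A = mat y"
      using scalar[OF A] by blast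
    thus False
      using noncomm by (simp add: mat2_simps mult.commute)
  next
    case False
    \<comment> \<open>The traceless part of \<open>A\<close>: its square is scalar and it
      anticommutes with \<open>B\<close>.\<close>
    define A1 where "A1 = A - mat (s / 2)"
    have "s / 2 \<in> Z"
      using Z_mult[OF s Z_inverse[OF Z_add[OF Z01(2) Z01(2)]]] by (simp add: field_simps)
    hence A1: "A1 \<in> S"
      using A by (simp add: A1_def diff Z_def)
    define a where "a = - det A1"
    have AA: "A1 ** A1 = mat a"
      unfolding a_def using False
      by (intro square_traceless_2) (simp add: A1_def mat_2 s_def field_simps)
    have a: "a \<in> Z"
      using mult[OF A1 A1] AA by (simp add: Z_def)
    have "A1 \<noteq> 0"
      using noncomm by (auto simp: A1_def mat2_simps mult.commute)
    hence "a \<noteq> 0"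
      using nozd[OF A1 A1] AA by auto
    have BA1: "B ** A1 = - (A1 ** B)"
    proof -
      have "B ** A1 = B ** A - B ** mat (s / 2)"
        by (simp add: A1_def mat2_simps algebra_simps)
      also have "\<dots> = - (A1 ** B) + (mat s ** B - mat (s / 2) ** B - B ** mat (s / 2))"
        unfolding BA by (simp add: A1_def mat2_simps algebra_simps)
      also have "mat s ** B - mat (s / 2) ** B - B ** mat (s / 2) = 0"
        using False by (simp add: mat2_simps field_simps)
      finally show ?thesis by simp
    qed
    \<comment> \<open>By anticommutation \<open>B + mat y ** A1\<close> has the scalar square
      \<open>b + a * y\<^sup>2\<close>. Once this equals \<open>x\<^sup>2\<close>, the difference of
      squares factors in \<open>S\<close>, and one factor must vanish.\<close>
    obtain x y where xy: "x \<in> Z" "y \<in> Z" "x\<^sup>2 = b + a * y\<^sup>2"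
      using exists_square_eq_add_mult_square[OF finZ Z01(1) a b \<open>a \<noteq> 0\<close> Z_add Z_mult] by blast
    define C where "C = B + mat y ** A1"
    have C: "C \<in> S"
      using B A1 xy by (simp add: C_def add mult Z_def)
    have "C ** C = B ** B + mat y ** (B ** A1 + A1 ** B) + mat (y * y) ** (A1 ** A1)"
      by (simp add: C_def mat2_simps algebra_simps)
    also have "\<dots> = mat (x * x)"
      using xy(3) by (simp add: BB AA BA1) (simp add: mat2_simps power2_eq_square algebra_simps)
    finally have "(C - mat x) ** (C + mat x) = 0"
      by (simp add: mat2_simps algebra_simps)
    moreover have "C - mat x \<in> S" "C + mat x \<in> S"
      using C xy by (simp_all add: Z_def add diff)
    ultimately have "C = mat x \<or> C = - mat x"
      using nozd[of "C - mat x" "C + mat x"] by (simp add: eq_neg_iff_add_eq_0)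
    \<comment> \<open>A scalar \<open>C\<close> commutes with \<open>A1\<close>, hence so does
      \<open>B\<close>. Together with anticommutation this makes twice the product zero.\<close>
    hence "C ** A1 = A1 ** C"
      by (auto simp: mat2_simps mult.commute)
    moreover have "B ** A1 = C ** A1 - mat y ** (A1 ** A1)" "A1 ** B = A1 ** C - mat y ** (A1 ** A1)"
      by (simp_all add: C_def mat2_simps algebra_simps)
    ultimately have "B ** A1 = A1 ** B"
      by simp
    hence "A1 ** B + A1 ** B = 0"
      using BA1 by (simp add: eq_neg_iff_add_eq_0)
    hence "(A1 ** B) $ i $ j + (A1 ** B) $ i $ j = 0" for i j
      by (metis vector_add_component zero_index)
    hence "A1 ** B = 0"
      using False by (simp add: mat2_eq_iff)
    thus False
      using nozd[OF A1 B(1)] \<open>A1 \<noteq> 0\<close> B(2) by simp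
  qed
qed

section \<open>The graph of a polynomial and its stabiliser\<close>

lemma mem_graph_of_iff: "v \<in> graph_of f \<longleftrightarrow> v $ 2 = poly f (v $ 1)"
proof -
  have "v = vector [v $ 1, v $ 2]"
    by (simp add: vec_eq_iff forall_2)
  thus ?thesis
    unfolding graph_of_def by (auto simp: vector_2)
qed

lemma mem_stab_set_iff:
  "A \<in> stab_set f \<longleftrightarrow>
    (\<forall>y. A$2$1 * y + A$2$2 * poly f y = poly f (A$1$1 * y + A$1$2 * poly f y))"
proof -
  have "A \<in> stab_set f \<longleftrightarrow> (\<forall>y. A *v vector [y, poly f y] \<in> graph_of f)"
    unfolding stab_set_def image_subset_iff by (auto simp: graph_of_def)
  thus ?thesis
    by (simp add: mem_graph_of_iff matrix_vector_mult_def sum_2)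
qed

lemma mult_mem_stab_set: "A \<in> stab_set f \<Longrightarrow> B \<in> stab_set f \<Longrightarrow> A ** B \<in> stab_set f"
  by (auto simp: stab_set_def image_subset_iff matrix_vector_mul_assoc[symmetric])

text \<open>Finiteness is used twice: injective left multiplications are onto, which supplies
  inverses inside the stabiliser, and a finite division ring of matrices is commutative.\<close>

lemma field_stab_ring:
  fixes f :: "'a::finite_field poly"
  assumes add: "\<And>x y. poly f (x + y) = poly f x + poly f y"
    and nonsing: "\<And>A. A \<in> stab_set f \<Longrightarrow> A \<noteq> 0 \<Longrightarrow> det A \<noteq> 0"
  shows "field (stab_ring f)"
proof -
  have f0: "poly f 0 = 0"
    using add[of 0 0] by (metis add_0 add_cancel_right_right)
  have f_diff: "poly f (x - y) = poly f x - poly f y" for x y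
    using add[of "x - y" y] by simp
  have zero: "0 \<in> stab_set f" and one: "mat 1 \<in> stab_set f"
    by (auto simp: mem_stab_set_iff mat_2 f0)
  have diff: "A - B \<in> stab_set f" if "A \<in> stab_set f" "B \<in> stab_set f" for A B
    unfolding mem_stab_set_iff
  proof
    fix y
    have "poly f ((A - B)$1$1 * y + (A - B)$1$2 * poly f y)
      = poly f ((A$1$1 * y + A$1$2 * poly f y) - (B$1$1 * y + B$1$2 * poly f y))"
      by (simp add: algebra_simps)
    also have "\<dots> = (A$2$1 * y + A$2$2 * poly f y) - (B$2$1 * y + B$2$2 * poly f y)"
      using that by (simp add: f_diff mem_stab_set_iff)
    finally show "(A - B)$2$1 * y + (A - B)$2$2 * poly f y
      = poly f ((A - B)$1$1 * y + (A - B)$1$2 * poly f y)"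
      by (simp add: algebra_simps)
  qed
  have closed: "A + B \<in> stab_set f" if "A \<in> stab_set f" "B \<in> stab_set f" for A B
    using diff[OF that(1) diff[OF zero that(2)]] by simp
  have inv: "\<exists>B\<in>stab_set f. A ** B = mat 1" if A: "A \<in> stab_set f" "A \<noteq> 0" for A
  proof -
    obtain A' where A': "A' ** A = mat 1"
      using nonsing[OF A] by (auto simp: invertible_det_nz[symmetric] invertible_def)
    have "inj_on (\<lambda>B. A ** B) (stab_set f)"
    proof
      fix X Y assume "A ** X = A ** Y"
      hence "(A' ** A) ** X = (A' ** A) ** Y"
        by (simp add: matrix_mul_assoc[symmetric])
      thus "X = Y"
        by (simp add: A')
    qed
    hence "(\<lambda>B. A ** B) ` stab_set f = stab_set f"
      by (intro endo_inj_surj) (auto simp: A mult_mem_stab_set)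
    thus ?thesis
      using one by (metis imageE)
  qed
  have comm: "A ** B = B ** A" if "A \<in> stab_set f" "B \<in> stab_set f" for A B
    by (rule finite_mat2_division_ring_commute[OF _ one diff mult_mem_stab_set inv that]) auto
  have "cring (stab_ring f)"
  proof (rule cringI)
    show "abelian_group (stab_ring f)"
    proof (rule abelian_groupI)
      fix A assume "A \<in> carrier (stab_ring f)"
      hence "0 - A \<in> stab_set f"
        using diff[OF zero] by (simp add: stab_ring_def)
      thus "\<exists>B\<in>carrier (stab_ring f). B \<oplus>\<^bsub>stab_ring f\<^esub> A = \<zero>\<^bsub>stab_ring f\<^esub>"
        by (intro bexI[of _ "0 - A"]) (simp_all add: stab_ring_def)
    qed (auto simp: stab_ring_def zero closed)
    show "comm_monoid (stab_ring f)"
      by (rule comm_monoidI) (auto simp: stab_ring_def one mult_mem_stab_set matrix_mul_assoc intro: comm)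
  qed (simp add: stab_ring_def mat2_simps algebra_simps)
  thus ?thesis
    by (rule cring.cring_fieldI2) (use inv in \<open>auto simp: stab_ring_def, simp add: mat2_simps\<close>)
qed

section \<open>Frobenius powers, \<open>q\<close>-polynomials and additive maps\<close>

lemma frobenius_power_sum:
  fixes g :: "'b \<Rightarrow> 'a::finite_field"
  assumes "CARD('a) = q ^ n" "primepow q"
  shows "(\<Sum>i\<in>A. g i) ^ (q ^ k) = (\<Sum>i\<in>A. g i ^ (q ^ k))"
proof -
  obtain p j where pj: "prime p" "q = p ^ j"
    using assms(2) by (auto simp: primepow_def)
  have "CHAR('a) = p"
    using CHAR_eq_primepow_base[OF assms(1) pj(2,1)] .
  moreover have "q ^ k = p ^ (j * k)"
    using pj by (simp add: power_mult)
  ultimately show ?thesis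
    using pj(1) by (intro freshmans_dream_sum'[of _ "j * k"]) auto
qed

lemma frobenius_power_add:
  fixes x y :: "'a::finite_field"
  assumes "CARD('a) = q ^ n" "primepow q"
  shows "(x + y) ^ (q ^ k) = x ^ (q ^ k) + y ^ (q ^ k)"
  using frobenius_power_sum[OF assms, of "\<lambda>b. if b then x else y" UNIV k]
  by (simp add: UNIV_bool add.commute)

lemma frobenius_power_diff:
  fixes x y :: "'a::finite_field"
  assumes "CARD('a) = q ^ n" "primepow q"
  shows "(x - y) ^ (q ^ k) = x ^ (q ^ k) - y ^ (q ^ k)"
  using frobenius_power_add[OF assms, of "x - y" y k] by simp

lemma poly_qpoly:
  fixes a :: "nat \<Rightarrow> 'a::comm_semiring_1"
  shows "poly (\<Sum>i<m. monom (a i) (q ^ i)) x = (\<Sum>i<m. a i * x ^ (q ^ i))"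
  by (simp add: poly_sum poly_monom)

lemma qpoly_add:
  fixes a :: "nat \<Rightarrow> 'a::finite_field"
  assumes "CARD('a) = q ^ n" "primepow q"
  shows "(\<Sum>i<m. a i * (x + y) ^ (q ^ i)) = (\<Sum>i<m. a i * x ^ (q ^ i)) + (\<Sum>i<m. a i * y ^ (q ^ i))"
  by (simp add: frobenius_power_add[OF assms] algebra_simps sum.distrib)

text \<open>The degree is at most \<open>q ^ (m - 1)\<close>, too small for \<open>q ^ m\<close>
  roots. This permits comparing coefficients on a subfield as well as on the whole field.\<close>

lemma qpoly_coeffs_eq_0:
  fixes a :: "nat \<Rightarrow> 'a::field"
  assumes "q > 1" "finite X" "card X \<ge> q ^ m"
    and zero: "\<And>x. x \<in> X \<Longrightarrow> (\<Sum>i<m. a i * x ^ (q ^ i)) = 0"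
    and "j < m"
  shows "a j = 0"
proof -
  define P where "P = (\<Sum>i<m. monom (a i) (q ^ i))"
  have "P = 0"
  proof (rule ccontr)
    assume P: "P \<noteq> 0"
    have "X \<subseteq> {x. poly P x = 0}"
      using zero by (auto simp: P_def poly_qpoly)
    hence "card X \<le> card {x. poly P x = 0}"
      using P by (intro card_mono poly_roots_finite)
    also have "\<dots> \<le> degree P"
      using P by (rule card_poly_roots_bound)
    also have "\<dots> \<le> q ^ (m - 1)"
      unfolding P_def using assms(1)
      by (intro degree_sum_le order.trans[OF degree_monom_le] power_increasing) auto
    also have "\<dots> < q ^ m"
      using assms(1,5) by (intro power_strict_increasing) auto
    finally show False
      using assms(3) by simp
  qed
  hence "0 = coeff P (q ^ j)"
    by simp
  also have "\<dots> = (\<Sum>i<m. if i = j then a i else 0)"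
    unfolding P_def coeff_sum coeff_monom using assms(1) by (intro sum.cong) auto
  also have "\<dots> = a j"
    using assms(5) by simp
  finally show ?thesis ..
qed

lemma sum_lessThan_add: "(\<Sum>i<m + k. F i) = (\<Sum>i<m. F i) + (\<Sum>i<k. F (i + m))"
  for F :: "nat \<Rightarrow> 'a::comm_monoid_add"
  by (induction k) (simp_all add: add.assoc add.commute[of m])

text \<open>Every nonempty fibre is a translate of the kernel.\<close>

lemma card_ker_times_card_range:
  fixes h :: "'a::{finite,ab_group_add} \<Rightarrow> 'b::ab_group_add"
  assumes add: "\<And>x y. h (x + y) = h x + h y"
  shows "CARD('a) = card {x. h x = 0} * card (range h)"
proof -
  have "card {x. h x = v} = card {x. h x = 0}" if v: "v \<in> range h" for v
  proof -
    obtain z where z: "v = h z"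
      using v by auto
    have "h (x - z) = h x - h z" for x
      using add[of "x - z" z] by simp
    thus ?thesis
      by (intro bij_betw_same_card[of "\<lambda>x. x - z"] bij_betwI[of _ _ _ "\<lambda>x. x + z"])
        (auto simp: z assms)
  qed
  moreover have "CARD('a) = (\<Sum>v\<in>range h. card {x. h x = v})"
    using sum.image_gen[of UNIV "\<lambda>_. 1 :: nat" h] by simp
  ultimately show ?thesis
    by simp
qed

text \<open>The rows are proportional; \<open>(a, b)\<close> is a nonzero row of \<open>A\<close>,
  the first one if possible.\<close>

lemma det_0_rank_one:
  fixes A :: "'a::field ^ 2 ^ 2"
  assumes "det A = 0" "A \<noteq> 0"
  obtains a b w1 w2 where "A$1$1 = a * w1" "A$1$2 = b * w1" "A$2$1 = a * w2" "A$2$2 = b * w2"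
    "a \<noteq> 0 \<or> b \<noteq> 0" "w1 \<noteq> 0 \<or> w2 \<noteq> 0"
proof -
  have det: "A$1$1 * A$2$2 = A$1$2 * A$2$1"
    using assms(1) by (simp add: det_2)
  show ?thesis
  proof (cases "A$1$1 = 0")
    case False
    show ?thesis
      by (rule that[of "A$1$1" 1 "A$1$2" "A$2$1 / A$1$1"]) (use False det in \<open>auto simp: field_simps\<close>)
  next
    case 11: True
    show ?thesis
    proof (cases "A$1$2 = 0")
      case False
      show ?thesis
        by (rule that[of "A$1$1" 1 "A$1$2" "A$2$2 / A$1$2"]) (use False det 11 in \<open>auto simp: field_simps\<close>)
    next
      case True
      show ?thesis
        by (rule that[of "A$2$1" 0 "A$2$2" 1]) (use True 11 assms in \<open>auto simp: mat2_eq_iff\<close>)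
    qed
  qed
qed

section \<open>Nilpotent elements of the stabiliser\<close>

lemma nilpotent_stab_set_transfer:
  assumes equiv: "qpoly_equiv f g" and N: "N \<in> stab_set g" "N \<noteq> 0" "N ** N = 0"
  shows "\<exists>B\<in>stab_set f. B \<noteq> 0 \<and> B ** B = 0"
proof -
  obtain M :: "'a ^ 2 ^ 2" and \<sigma> where M: "invertible M" and \<sigma>: "\<sigma> \<in> field_aut"
    and im: "(\<lambda>v. M *v (\<chi> i. \<sigma> (v $ i))) ` graph_of f = graph_of g"
    using equiv by (auto simp: qpoly_equiv_def GammaL2_def)
  have bij: "bij \<sigma>" and add: "\<sigma> (x + y) = \<sigma> x + \<sigma> y" and mult: "\<sigma> (x * y) = \<sigma> x * \<sigma> y" for x y
    using \<sigma> by (auto simp: field_aut_def)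
  have \<sigma>0: "\<sigma> 0 = 0"
    using add[of 0 0] by (metis add_0 add_cancel_right_right)
  have \<sigma>_inj: "\<sigma> x = \<sigma> y \<longleftrightarrow> x = y" for x y
    using bij by (auto simp: bij_def inj_def)
  obtain M' where M': "M ** M' = mat 1" "M' ** M = mat 1"
    using M by (auto simp: invertible_def)
  \<comment> \<open>Conjugation by \<open>M\<close> undoes the linear part of the equivalence;
    applying the inverse of \<open>\<sigma>\<close> to each entry undoes the semilinear
    part.\<close>
  define P where "P = M' ** N ** M"
  define B :: "'a ^ 2 ^ 2" where "B = (\<chi> i j. inv_into UNIV \<sigma> (P $ i $ j))"
  have \<sigma>B: "\<sigma> (B $ i $ j) = P $ i $ j" for i j
    using bij by (simp add: B_def bij_def surj_f_inv_f)
  have MP: "M ** P = N ** M"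
    by (simp add: P_def matrix_mul_assoc M')
  have "B \<noteq> 0"
  proof
    assume "B = 0"
    hence "P = 0"
      using \<sigma>B[of 1 1] \<sigma>B[of 1 2] \<sigma>B[of 2 1] \<sigma>B[of 2 2] by (simp add: mat2_eq_iff \<sigma>0)
    hence "N ** (M ** M') = 0"
      using MP by (simp add: matrix_mul_assoc)
    thus False
      using N by (simp add: M')
  qed
  moreover have "B ** B = 0"
  proof -
    have "P ** P = M' ** N ** (M ** P)"
      by (simp add: P_def matrix_mul_assoc)
    also have "\<dots> = M' ** (N ** N) ** M"
      by (simp add: MP matrix_mul_assoc)
    finally have PP: "P ** P = 0"
      by (simp add: N)
    have "\<sigma> ((B ** B) $ i $ j) = \<sigma> 0" for i j
      using arg_cong[OF PP, of "\<lambda>C. C $ i $ j"] by (simp add: matrix_mult_2 add mult \<sigma>B \<sigma>0)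
    thus ?thesis
      by (simp add: \<sigma>_inj mat2_eq_iff)
  qed
  moreover have "B *v v \<in> graph_of f" if v: "v \<in> graph_of f" for v
  proof -
    have "(\<chi> i. \<sigma> ((B *v v) $ i)) = P *v (\<chi> i. \<sigma> (v $ i))"
      by (simp add: vec_eq_iff matrix_vector_mult_def sum_2 add mult \<sigma>B)
    hence "M *v (\<chi> i. \<sigma> ((B *v v) $ i)) = N *v (M *v (\<chi> i. \<sigma> (v $ i)))"
      by (simp add: matrix_vector_mul_assoc MP)
    also have "\<dots> \<in> graph_of g"
      using N(1) v im by (auto simp: stab_set_def)
    finally obtain u where u: "u \<in> graph_of f"
      "M *v (\<chi> i. \<sigma> ((B *v v) $ i)) = M *v (\<chi> i. \<sigma> (u $ i))"
      using im by (metis (no_types, lifting) imageE)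
    hence "M' *v (M *v (\<chi> i. \<sigma> ((B *v v) $ i))) = M' *v (M *v (\<chi> i. \<sigma> (u $ i)))"
      by simp
    hence "(\<chi> i. \<sigma> ((B *v v) $ i)) = (\<chi> i. \<sigma> (u $ i))"
      by (simp add: matrix_vector_mul_assoc M')
    hence "B *v v = u"
      by (simp add: vec_eq_iff \<sigma>_inj)
    thus ?thesis
      using u by simp
  qed
  ultimately show ?thesis
    by (auto simp: stab_set_def)
qed

lemma field_stab_ring_reduced:
  assumes "field (stab_ring f)" "B \<in> stab_set f" "B ** B = 0"
  shows "B = 0"
proof -
  interpret field "stab_ring f"
    by (rule assms(1))
  show ?thesis
    using integral[of B B] assms(2,3) by (simp add: stab_ring_def)
qed

text \<open>For \<open>x\<close> outside the subfield of order \<open>q ^ t\<close>, take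
  \<open>x ^ (q ^ t) - x\<close>: since \<open>x ^ (q ^ (2 * t)) = x\<close>, raising to the power
  \<open>q ^ t\<close> exchanges the two terms.\<close>

lemma exists_frobenius_power_eq_uminus:
  assumes "CARD('a::finite_field) = q ^ (2 * t)" "primepow q" "0 < t"
  shows "\<exists>\<delta>::'a. \<delta> \<noteq> 0 \<and> \<delta> ^ (q ^ t) = - \<delta>"
proof -
  have q: "q > 1"
    using primepow_gt_Suc_0[OF assms(2)] by simp
  have "card (GF_sub (q ^ t) :: 'a set) = q ^ t"
    by (rule card_GF_sub[OF assms(1,2)]) (use assms(3) in auto)
  also have "\<dots> < CARD('a)"
    unfolding assms(1) using q assms(3) by (intro power_strict_increasing) auto
  finally have "(GF_sub (q ^ t) :: 'a set) \<noteq> UNIV"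
    by auto
  then obtain x :: 'a where x: "x ^ (q ^ t) \<noteq> x"
    by (auto simp: GF_sub_def)
  have "(x ^ (q ^ t)) ^ (q ^ t) = x"
    using finite_field_power_card_eq_same[of x] assms(1)
    by (simp add: power_mult[symmetric] power_add[symmetric] mult_2)
  thus ?thesis
    using x by (intro exI[of _ "x ^ (q ^ t) - x"]) (simp add: frobenius_power_diff[OF assms(1,2)])
qed

lemma nilpotent_in_stab_set:
  fixes l :: "'a::finite_field poly"
  assumes "CARD('a) = q ^ (2 * t)" "primepow q" "0 < t" "l \<in> qpolys q t"
  shows "\<exists>N\<in>stab_set (l ^ (q ^ t) - l). N \<noteq> 0 \<and> N ** N = 0"
proof -
  define g where "g = l ^ (q ^ t) - l"
  obtain \<delta> :: 'a where \<delta>: "\<delta> \<noteq> 0" "\<delta> ^ (q ^ t) = - \<delta>"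
    using exists_frobenius_power_eq_uminus[OF assms(1-3)] by blast
  have g: "poly g y = poly l y ^ (q ^ t) - poly l y" for y
    by (simp add: g_def)
  have twice: "(x ^ (q ^ t)) ^ (q ^ t) = x" for x :: 'a
    using finite_field_power_card_eq_same[of x] assms(1)
    by (simp add: power_mult[symmetric] power_add[symmetric] mult_2)
  \<comment> \<open>The power \<open>q ^ t\<close> negates both the values of \<open>g\<close> and
    \<open>\<delta>\<close>, so it fixes their quotient.\<close>
  have g_image: "poly g y / \<delta> \<in> GF_sub (q ^ t)" for y
    using \<delta>(1) by (simp add: GF_sub_def power_divide \<delta>(2) g frobenius_power_diff[OF assms(1,2)] twice
        divide_simps)
  obtain a where a: "l = (\<Sum>i<t. monom (a i) (q ^ i))" "\<And>i. i < t \<Longrightarrow> a i \<in> GF_sub (q ^ t)"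
    using assms(4) by (auto simp: qpolys_def)
  \<comment> \<open>On the subfield, the power \<open>q ^ t\<close> fixes the coefficients of
    \<open>l\<close> and the powers of \<open>y\<close>, so the two terms of \<open>g\<close>
    agree.\<close>
  have g_kernel: "poly g y = 0" if "y \<in> GF_sub (q ^ t)" for y
  proof -
    have "(y ^ (q ^ i)) ^ (q ^ t) = y ^ (q ^ i)" for i
      using that by (simp add: GF_sub_def power_mult[symmetric] mult.commute[of "q ^ i"])
        (simp add: power_mult)
    hence "poly l y ^ (q ^ t) = poly l y"
      unfolding a(1) poly_qpoly frobenius_power_sum[OF assms(1,2)]
      using a(2) by (intro sum.cong) (auto simp: power_mult_distrib GF_sub_def)
    thus ?thesis
      by (simp add: g)
  qed
  \<comment> \<open>\<open>N\<close> sends \<open>(y, g y)\<close> to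
    \<open>(g y / \<delta>, 0)\<close>, which lies on the graph since \<open>g\<close> vanishes on
    the subfield.\<close>
  define N :: "'a ^ 2 ^ 2" where "N = vector [vector [0, 1 / \<delta>], vector [0, 0]]"
  have "N \<noteq> 0" "N ** N = 0" "N \<in> stab_set g"
    using \<delta>(1) g_kernel[OF g_image] by (auto simp: mat2_simps N_def mem_stab_set_iff)
  thus ?thesis
    unfolding g_def by blast
qed

section \<open>From a singular stabilising matrix to the standard form\<close>

lemma singular_stab_imp_standard_form:
  fixes f :: "'a::finite_field poly"
  assumes q: "primepow q" and card: "CARD('a) = q ^ n"
    and t: "t dvd n" "1 < t" "t < n"
    and f: "f \<in> qpolys q n" and scattered: "L_partially_scattered (q ^ t) f"
    and A: "A \<in> stab_set f" "A \<noteq> 0" "det A = 0"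
  shows "n = 2 * t \<and> (\<exists>l \<in> qpolys q t. qpoly_equiv f (l ^ (q ^ t) - l))"
proof -
  have q1: "q > 1"
    using primepow_gt_Suc_0[OF q] by simp
  define K where "K = (GF_sub (q ^ t) :: 'a set)"
  have cardK: "card K = q ^ t"
    unfolding K_def using card_GF_sub[OF card q t(1)] t by simp
  have qtn: "q ^ t < q ^ n"
    using q1 t by simp
  obtain fc where fc: "poly f y = (\<Sum>i<n. fc i * y ^ (q ^ i))" for y
    using f by (auto simp: qpolys_def poly_qpoly)
  have f_add: "poly f (x + y) = poly f x + poly f y" for x y
    unfolding fc by (rule qpoly_add[OF card q])
  have f0: "poly f 0 = 0"
    using f_add[of 0 0] by (metis add_0 add_cancel_right_right)
  have scat: "y / z \<in> K" if "y \<noteq> 0" "z \<noteq> 0" "poly f y / y = poly f z / z" for y z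
    using scattered that unfolding L_partially_scattered_def K_def by blast

  obtain a b w1 w2 where rank1: "A$1$1 = a * w1" "A$1$2 = b * w1" "A$2$1 = a * w2" "A$2$2 = b * w2"
    "a \<noteq> 0 \<or> b \<noteq> 0" "w1 \<noteq> 0 \<or> w2 \<noteq> 0"
    using det_0_rank_one[OF A(3,2)] .
  define \<psi> where "\<psi> y = a * y + b * poly f y" for y
  have \<psi>_add: "\<psi> (x + y) = \<psi> x + \<psi> y" for x y
    by (simp add: \<psi>_def f_add algebra_simps)
  \<comment> \<open>\<open>A\<close> maps \<open>(y, f y)\<close> to \<open>\<psi> y\<close> times
    \<open>(w1, w2)\<close>, and this is again a point of the graph.\<close>
  have image: "\<psi> y * w2 = poly f (\<psi> y * w1)" for y
    using A(1)[unfolded mem_stab_set_iff, rule_format, of y] by (simp add: rank1 \<psi>_def algebra_simps)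
  \<comment> \<open>If \<open>b\<close> were 0, then \<open>\<psi>\<close> would be multiplication
    by a nonzero \<open>a\<close>. Otherwise all nonzero kernel elements share the slope
    \<open>- a / b\<close>, and scatteredness applies.\<close>
  have kernel_ratio: "b \<noteq> 0 \<and> y / z \<in> K" if "y \<noteq> 0" "z \<noteq> 0" "\<psi> y = 0" "\<psi> z = 0" for y z
  proof -
    have "b \<noteq> 0"
      using that rank1(5) by (auto simp: \<psi>_def)
    have "poly f x / x = - a / b" if "x \<noteq> 0" "\<psi> x = 0" for x
    proof -
      have "b * poly f x = - a * x"
        using that(2) by (simp add: \<psi>_def add_eq_0_iff)
      thus ?thesis
        using that(1) \<open>b \<noteq> 0\<close> by (simp add: field_simps)
    qed
    thus ?thesis
      using that scat \<open>b \<noteq> 0\<close> by simp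
  qed
  have kernel_le: "{y. \<psi> y = 0} \<subseteq> (\<lambda>k. k * y0) ` K" if y0: "y0 \<noteq> 0" "\<psi> y0 = 0" for y0
  proof
    fix y assume y: "y \<in> {y. \<psi> y = 0}"
    show "y \<in> (\<lambda>k. k * y0) ` K"
    proof (cases "y = 0")
      case True
      thus ?thesis
        using GF_sub_closed(1)[OF q] by (auto simp: K_def intro!: image_eqI[of _ _ 0])
    next
      case False
      thus ?thesis
        using y kernel_ratio[of y y0] y0 by (auto intro!: image_eqI[of _ _ "y / y0"])
    qed
  qed
  have card_kernel_le: "card {y. \<psi> y = 0} \<le> q ^ t"
  proof (cases "\<exists>y0. y0 \<noteq> 0 \<and> \<psi> y0 = 0")
    case True
    then obtain y0 where "y0 \<noteq> 0" "\<psi> y0 = 0"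
      by blast
    hence "card {y. \<psi> y = 0} \<le> card ((\<lambda>k. k * y0) ` K)"
      by (intro card_mono kernel_le) auto
    also have "\<dots> \<le> q ^ t"
      unfolding cardK[symmetric] by (rule card_image_le) simp
    finally show ?thesis .
  next
    case False
    hence "card {y. \<psi> y = 0} \<le> card {0::'a}"
      by (intro card_mono) auto
    also have "\<dots> \<le> q ^ t"
      using q1 by simp
    finally show ?thesis .
  qed
  obtain y1 where y1: "\<psi> y1 \<noteq> 0"
  proof -
    have "{y. \<psi> y = 0} \<noteq> UNIV"
      using card_kernel_le qtn card by auto
    thus ?thesis
      using that by auto
  qed
  have w1: "w1 \<noteq> 0"
    using image[of y1] y1 rank1(6) f0 by auto
  \<comment> \<open>By \<open>image\<close>, all nonzero points \<open>\<psi> y * w1\<close> share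
    the slope \<open>w2 / w1\<close>, so scatteredness applies to the range too.\<close>
  have \<psi>_ratio: "\<psi> y / \<psi> y1 \<in> K" for y
  proof (cases "\<psi> y = 0")
    case True
    thus ?thesis
      using GF_sub_closed(1)[OF q] by (simp add: K_def)
  next
    case False
    have "poly f (\<psi> y * w1) / (\<psi> y * w1) = poly f (\<psi> y1 * w1) / (\<psi> y1 * w1)"
      using False y1 w1 by (simp add: image[symmetric])
    hence "(\<psi> y * w1) / (\<psi> y1 * w1) \<in> K"
      using False y1 w1 by (intro scat) auto
    thus ?thesis
      using w1 by simp
  qed
  have card_range_le: "card (range \<psi>) \<le> q ^ t"
  proof -
    have "range \<psi> \<subseteq> (\<lambda>k. k * \<psi> y1) ` K"
    proof safe
      fix y
      show "\<psi> y \<in> (\<lambda>k. k * \<psi> y1) ` K"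
        using \<psi>_ratio[of y] y1 by (auto intro!: image_eqI[of _ _ "\<psi> y / \<psi> y1"])
    qed
    hence "card (range \<psi>) \<le> card ((\<lambda>k. k * \<psi> y1) ` K)"
      by (intro card_mono) auto
    also have "\<dots> \<le> q ^ t"
      unfolding cardK[symmetric] by (rule card_image_le) simp
    finally show ?thesis .
  qed
  have rank_nullity: "q ^ n = card {y. \<psi> y = 0} * card (range \<psi>)"
    using card_ker_times_card_range[of \<psi>, OF \<psi>_add] card by simp
  obtain y0 where y0: "y0 \<noteq> 0" "\<psi> y0 = 0"
  proof -
    have "\<exists>y0. y0 \<noteq> 0 \<and> \<psi> y0 = 0"
    proof (rule ccontr)
      assume "\<not> ?thesis"
      hence "card {y. \<psi> y = 0} \<le> card {0::'a}"
        by (intro card_mono) auto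
      hence "card {y. \<psi> y = 0} * card (range \<psi>) \<le> 1 * q ^ t"
        using card_range_le by (intro mult_mono) auto
      thus False
        using rank_nullity qtn by simp
    qed
    thus ?thesis
      using that by blast
  qed
  have b: "b \<noteq> 0"
    using kernel_ratio[of y0 y0] y0 by simp

  have n: "n = 2 * t"
  proof -
    have "q ^ n \<le> q ^ t * q ^ t"
      unfolding rank_nullity using card_kernel_le card_range_le by (intro mult_mono) auto
    hence "q ^ n \<le> q ^ (2 * t)"
      by (simp add: power_add[symmetric] mult_2)
    hence "n \<le> 2 * t"
      using q1 by simp
    moreover obtain m where m: "n = t * m"
      using t(1) by auto
    ultimately have "m \<le> 2" "m > 1"
      using t by (auto simp: mult.commute)
    hence "m = 2"
      by simp
    thus ?thesis
      using m by simp
  qed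
  \<comment> \<open>Now \<open>q ^ n = q ^ t * q ^ t\<close>, so the kernel cannot be smaller than
    its bound and fills \<open>y0\<close> times \<open>K\<close>.\<close>
  have kernel: "\<psi> (k * y0) = 0" if "k \<in> K" for k
  proof -
    have "q ^ t * q ^ t = q ^ n"
      by (simp add: n power_add[symmetric] mult_2)
    also have "\<dots> \<le> card {y. \<psi> y = 0} * q ^ t"
      unfolding rank_nullity using card_range_le by (intro mult_mono) auto
    finally have "q ^ t \<le> card {y. \<psi> y = 0}"
      using q1 by simp
    moreover have "card ((\<lambda>k. k * y0) ` K) \<le> q ^ t"
      unfolding cardK[symmetric] by (rule card_image_le) simp
    ultimately have "{y. \<psi> y = 0} = (\<lambda>k. k * y0) ` K"
      by (intro card_seteq kernel_le[OF y0]) auto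
    thus ?thesis
      using that by auto
  qed

  \<comment> \<open>Normalisation and comparison of coefficients\<close>
  obtain \<delta> :: 'a where \<delta>: "\<delta> \<noteq> 0" "\<delta> ^ (q ^ t) = - \<delta>"
    using exists_frobenius_power_eq_uminus[of q t, where ?'a = 'a] card q t n by auto
  \<comment> \<open>The range of \<open>\<psi>\<close> lies in \<open>\<psi> y1\<close> times
    \<open>K\<close>; the factor \<open>c\<close> moves it into \<open>\<delta>\<close> times
    \<open>K\<close>, where the power \<open>q ^ t\<close> acts as negation.\<close>
  define c where "c = \<delta> / \<psi> y1"
  have c: "c \<noteq> 0"
    using \<delta>(1) y1 by (simp add: c_def)
  define g where "g x = c * \<psi> (x * y0)" for x
  have g_kernel: "g x = 0" if "x \<in> K" for x
    using kernel[OF that] by (simp add: g_def)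
  have g_twist: "g x ^ (q ^ t) = - g x" for x
  proof -
    have "g x = \<delta> * (\<psi> (x * y0) / \<psi> y1)"
      by (simp add: g_def c_def)
    moreover have "(\<psi> (x * y0) / \<psi> y1) ^ (q ^ t) = \<psi> (x * y0) / \<psi> y1"
      using \<psi>_ratio by (simp add: K_def GF_sub_def)
    ultimately show ?thesis
      by (simp only: power_mult_distrib \<delta>(2)) simp
  qed

  \<comment> \<open>The summand \<open>a * y\<close> of \<open>\<psi>\<close> is linear, so it only
    contributes to the exponent \<open>q ^ 0\<close>.\<close>
  define gc where "gc i = c * (b * fc i * y0 ^ (q ^ i) + (if i = 0 then a * y0 else 0))" for i
  have g_gc: "g x = (\<Sum>i<n. gc i * x ^ (q ^ i))" for x
  proof -
    have "(\<Sum>i<n. (if i = 0 then a * y0 else 0) * x ^ (q ^ i)) = (\<Sum>i<n. if i = 0 then a * y0 * x else 0)"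
      by (intro sum.cong) auto
    also have "\<dots> = a * y0 * x"
      using t by simp
    finally have "a * (x * y0) = (\<Sum>i<n. (if i = 0 then a * y0 else 0) * x ^ (q ^ i))"
      by (simp add: mult_ac)
    moreover have "b * poly f (x * y0) = (\<Sum>i<n. b * fc i * y0 ^ (q ^ i) * x ^ (q ^ i))"
      unfolding fc sum_distrib_left by (intro sum.cong) (auto simp: power_mult_distrib mult_ac)
    ultimately have "\<psi> (x * y0)
      = (\<Sum>i<n. (b * fc i * y0 ^ (q ^ i) + (if i = 0 then a * y0 else 0)) * x ^ (q ^ i))"
      unfolding \<psi>_def by (simp add: sum.distrib[symmetric] distrib_right add.commute)
    thus ?thesis
      unfolding g_def gc_def by (simp add: sum_distrib_left mult.assoc)
  qed
  define e where "e i = gc (i + t)" for i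
  \<comment> \<open>On \<open>K\<close> the exponents \<open>q ^ (i + t)\<close> and
    \<open>q ^ i\<close> agree, so \<open>g\<close> restricts to a \<open>q\<close>-polynomial with
    only \<open>t\<close> coefficients \<open>gc i + e i\<close> and \<open>q ^ t\<close>
    zeros.\<close>
  have gc_e: "gc i = - e i" if "i < t" for i
  proof -
    have "gc i + e i = 0"
    proof (rule qpoly_coeffs_eq_0[of q K t "\<lambda>i. gc i + e i"])
      fix x assume x: "x \<in> K"
      have "x ^ (q ^ (i + t)) = x ^ (q ^ i)" for i
        using x by (simp add: K_def GF_sub_def power_add mult.commute[of "q ^ i"]) (simp add: power_mult)
      hence "(\<Sum>i<t. (gc i + e i) * x ^ (q ^ i)) = g x"
        unfolding g_gc n mult_2 sum_lessThan_add by (simp add: e_def sum.distrib distrib_right)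
      thus "(\<Sum>i<t. (gc i + e i) * x ^ (q ^ i)) = 0"
        using g_kernel[OF x] by simp
    qed (use q1 cardK that in auto)
    thus ?thesis
      by (simp add: eq_neg_iff_add_eq_0)
  qed
  have g_e: "g x = (\<Sum>i<t. e i * (x ^ (q ^ (i + t)) - x ^ (q ^ i)))" for x
    unfolding g_gc n mult_2 sum_lessThan_add
    by (simp add: gc_e e_def[symmetric] right_diff_distrib sum_subtractf sum_negf)
  have x_n: "x ^ (q ^ (i + t + t)) = x ^ (q ^ i)" for x :: 'a and i
  proof -
    have "x ^ (q ^ (i + t + t)) = (x ^ (q ^ n)) ^ (q ^ i)"
      by (simp add: power_mult[symmetric] power_add[symmetric] n mult_2 add_ac)
    thus ?thesis
      using finite_field_power_card_eq_same[of x] card by simp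
  qed
  have e_K: "e i \<in> K" if "i < t" for i
  proof -
    \<comment> \<open>The identity \<open>g x ^ (q ^ t) + g x = 0\<close> becomes a
      \<open>q\<close>-polynomial with coefficients \<open>- d i\<close> in the lower half and
      \<open>d i\<close> in the upper half, vanishing on the whole field.\<close>
    define d where "d i = e i - e i ^ (q ^ t)" for i
    have "(if i < t then - d i else d (i - t)) = 0"
    proof (rule qpoly_coeffs_eq_0[of q UNIV n "\<lambda>i. if i < t then - d i else d (i - t)"])
      fix x :: 'a
      have "g x ^ (q ^ t) = (\<Sum>i<t. e i ^ (q ^ t) * (x ^ (q ^ i) - x ^ (q ^ (i + t))))"
        unfolding g_e frobenius_power_sum[OF card q] power_mult_distrib frobenius_power_diff[OF card q]
        by (simp add: power_mult[symmetric] power_add[symmetric] x_n)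
      hence "(\<Sum>i<t. e i ^ (q ^ t) * (x ^ (q ^ i) - x ^ (q ^ (i + t)))) + g x = 0"
        by (simp add: g_twist[of x] flip: eq_neg_iff_add_eq_0)
      hence "(\<Sum>i<t. d i * (x ^ (q ^ (i + t)) - x ^ (q ^ i))) = 0"
        unfolding g_e d_def sum.distrib[symmetric] by (simp add: algebra_simps)
      thus "(\<Sum>i<n. (if i < t then - d i else d (i - t)) * x ^ (q ^ i)) = 0"
        unfolding n mult_2 sum_lessThan_add
        by (simp add: right_diff_distrib sum_subtractf sum_negf)
    qed (use q1 card n that in auto)
    thus ?thesis
      using that by (simp add: d_def K_def GF_sub_def)
  qed

  \<comment> \<open>The polynomial \<open>l\<close> and the equivalence\<close>
  define l where "l = (\<Sum>i<t. monom (e i) (q ^ i))"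
  have l: "l \<in> qpolys q t"
    unfolding qpolys_def l_def using e_K by (auto simp: K_def)
  have l_g: "poly (l ^ (q ^ t) - l) x = g x" for x
  proof -
    have "poly l x ^ (q ^ t) = (\<Sum>i<t. e i * x ^ (q ^ (i + t)))"
      unfolding l_def poly_qpoly frobenius_power_sum[OF card q] power_mult_distrib
      using e_K by (intro sum.cong)
        (auto simp: K_def GF_sub_def power_mult[symmetric] power_add[symmetric])
    thus ?thesis
      by (simp add: g_e l_def poly_qpoly right_diff_distrib sum_subtractf)
  qed
  \<comment> \<open>\<open>M\<close> sends \<open>(y, f y)\<close> to
    \<open>(y / y0, c * \<psi> y)\<close>, which is \<open>(x, g x)\<close> for
    \<open>y = x * y0\<close>. No field automorphism other than \<open>id\<close> is
    involved.\<close>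
  define M :: "'a ^ 2 ^ 2" where "M = vector [vector [1 / y0, 0], vector [c * a, c * b]]"
  have M: "invertible M"
    using y0 b c by (simp add: invertible_det_nz det_2 M_def)
  have M_vec: "M *v v = vector [v $ 1 / y0, c * (a * v $ 1 + b * v $ 2)]" for v
    by (simp add: vec_eq_iff forall_2 M_def matrix_vector_mult_def sum_2 algebra_simps)
  have "(\<lambda>v. M *v (\<chi> i. id (v $ i))) ` graph_of f = graph_of (l ^ (q ^ t) - l)"
  proof safe
    fix v assume "v \<in> graph_of f"
    thus "M *v (\<chi> i. id (v $ i)) \<in> graph_of (l ^ (q ^ t) - l)"
      using y0 by (simp only: mem_graph_of_iff l_g) (simp add: M_vec g_def \<psi>_def)
  next
    fix v assume v: "v \<in> graph_of (l ^ (q ^ t) - l)"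
    hence "v = M *v (\<chi> i. id (vector [v $ 1 * y0, poly f (v $ 1 * y0)] $ i))"
      using y0 by (simp only: mem_graph_of_iff l_g) (simp add: M_vec vec_eq_iff forall_2 g_def \<psi>_def)
    thus "v \<in> (\<lambda>v. M *v (\<chi> i. id (v $ i))) ` graph_of f"
      by (rule image_eqI) (simp add: mem_graph_of_iff)
  qed
  moreover have "(id :: 'a \<Rightarrow> 'a) \<in> field_aut"
    by (simp add: field_aut_def)
  ultimately have "qpoly_equiv f (l ^ (q ^ t) - l)"
    unfolding qpoly_equiv_def GammaL2_def using M by blast
  thus ?thesis
    using n l by blast
qed

theorem theorem3p6:
  fixes q n t :: nat and f :: "'a::finite_field poly"
  assumes "primepow q" and "0 < n"
    and "CARD('a) = q ^ n"
    and "t dvd n" and "1 < t" and "t < n"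
    and "f \<in> qpolys q n"
    and "L_partially_scattered (q ^ t) f"
  shows "\<not> field (stab_ring f) \<longleftrightarrow>
    n = 2 * t \<and> (\<exists>l \<in> qpolys q t. qpoly_equiv f (l ^ (q ^ t) - l))"
proof
  assume not_field: "\<not> field (stab_ring f)"
  have "poly f (x + y) = poly f x + poly f y" for x y
    using assms(7) by (auto simp: qpolys_def poly_qpoly qpoly_add[OF assms(3,1)])
  then obtain A where "A \<in> stab_set f" "A \<noteq> 0" "det A = 0"
    using field_stab_ring not_field by blast
  thus "n = 2 * t \<and> (\<exists>l \<in> qpolys q t. qpoly_equiv f (l ^ (q ^ t) - l))"
    using singular_stab_imp_standard_form[OF assms(1,3-8)] by blast
next
  assume "n = 2 * t \<and> (\<exists>l \<in> qpolys q t. qpoly_equiv f (l ^ (q ^ t) - l))"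
  then obtain l where n: "n = 2 * t" and l: "l \<in> qpolys q t" "qpoly_equiv f (l ^ (q ^ t) - l)"
    by blast
  obtain N where "N \<in> stab_set (l ^ (q ^ t) - l)" "N \<noteq> 0" "N ** N = 0"
    using nilpotent_in_stab_set[OF _ assms(1) _ l(1)] assms(3,5) n by auto
  then obtain B where "B \<in> stab_set f" "B \<noteq> 0" "B ** B = 0"
    using nilpotent_stab_set_transfer[OF l(2)] by blast
  thus "\<not> field (stab_ring f)"
    using field_stab_ring_reduced by blast
qed

end
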